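(* Suppose the energy separates as $G(x;\kappa)=\sum_{i=1}^M g_i(\kappa_i)\,\widetilde G_i(x)$, and let $K(\kappa)=\sum_{i=1}^M f_i(\kappa_i)$ where $f_i'=g_i/g_i'$ (for conductance training, $g_i(\kappa_i)=\kappa_i$, one has $K=\tfrac12\sum_i\kappa_i^2$). Then along the zero-nudge adjoint coupled learning (AL) flow $$\dot K=-\lVert\mu_0\rVert^2=-2\,\Phi^*,$$ where $\mu_0=\mu_0(\kappa)$ is the adjoint error and $\Phi^*=\tfrac12\lVert\mu_0\rVert^2$ is the adjoint loss. Consequently, along the continuous-time flow, $K$ decreases strictly whenever the objective is not yet met (i.e. whenever $\mu_0\neq0$).
   Context: Setting. $x\in\mathbb R^N$ is the vector of node voltages and $\kappa=(\kappa_1,\dots,\kappa_M)$ the vector of trainable parameters, ranging over an open set. The matrix $P\in\mathbb R^{N\times I}$ has as columns the distinct standard basis vectors of $\mathbb R^N$ corresponding to the input nodes (ground included), and $Q\in\mathbb R^{N\times O}$ has as columns the distinct standard basis vectors corresponding to the output nodes; input and output nodes are disjoint. An input $v\in\mathbb R^I$ and a target $w\in\mathbb R^O$ are fixed. The functions $g_i$ and $\widetilde G_i$ are smooth (of $\kappa_i$ and of $x\in\mathbb R^N$ respectively), with $g_i'\ne0$. Reference state and adjoint error. For each $\kappa$ considered, the doubly constrained reference state $x_0^*=\arg\min\{G(x;\kappa):P^\top x=v,\ Q^\top x=w\}$ exists and is unique, and the Hessian $H^*=\nabla_x^2G(x_0^*;\kappa)$ is positive definite on $\ker P^\top$. The multipliers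 $\lambda_0\in\mathbb R^I$, $\mu_0\in\mathbb R^O$ are defined by the stationarity condition $$\nabla_xG(x_0^*;\kappa)=-P\lambda_0-Q\mu_0;$$ $\mu_0$ (the output constraint force) is the adjoint error. AL flow. Let $R_{\mathrm{AL}}$ be the input-constrained resolvent at the reference state: for $f\in\mathbb R^N$, $R_{\mathrm{AL}}f$ is the unique $y$ for which there is $\nu\in\mathbb R^I$ with $H^*y+P\nu=f$ and $P^\top y=0$. Let $D_{\mathrm{AL}}=(Q^\top R_{\mathrm{AL}}Q)^{-1}$ and $y=R_{\mathrm{AL}}QD_{\mathrm{AL}}\mu_0$. The zero-nudge AL flow is $$\dot\kappa_i=\bigl\langle y,\ \partial_{\kappa_i}\nabla_xG(x_0^*;\kappa)\bigr\rangle,\qquad i=1,\dots,M.$$ In the linear resistive circuit case, $G(x;\kappa)=\tfrac12\sum_e\kappa_e(d_e^\top x)^2$ with incidence vectors $d_e\in\mathbb R^N$, this reads $\dot\kappa_e=(d_e^\top y)(d_e^\top x_0^* )$. *)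

theory Defs
  imports "HOL-Analysis.Analysis"
begin

text \<open>Meant for open \<open>S\<close>, where it is the usual notion of a \<open>C\<^sup>k\<close> map.\<close>

primrec Ck_on :: "nat \<Rightarrow> 'a set \<Rightarrow> ('a::euclidean_space \<Rightarrow> 'b::real_normed_vector) \<Rightarrow> bool" where
  "Ck_on 0 S f \<longleftrightarrow> continuous_on S f"
| "Ck_on (Suc k) S f \<longleftrightarrow>
     (\<forall>x\<in>S. f differentiable (at x)) \<and> (\<forall>h. Ck_on k S (\<lambda>x. frechet_derivative f (at x) h))"

definition smooth_on :: "'a set \<Rightarrow> ('a::euclidean_space \<Rightarrow> 'b::real_normed_vector) \<Rightarrow> bool" where
  "smooth_on S f \<longleftrightarrow> (\<forall>k. Ck_on k S f)"

definition gradient :: "('a::real_inner \<Rightarrow> real) \<Rightarrow> 'a \<Rightarrow> 'a" where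
  "gradient f x = (THE D. GDERIV f x :> D)"

definition hessian :: "(real^'n \<Rightarrow> real) \<Rightarrow> real^'n \<Rightarrow> real^'n^'n" where
  "hessian f x = jacobian (gradient f) (at x)"

text \<open>Symmetry is not demanded: it is used for Hessians of smooth functions.\<close>

definition pos_def_on :: "(real^'n) set \<Rightarrow> real^'n^'n \<Rightarrow> bool" where
  "pos_def_on V H \<longleftrightarrow> (\<forall>h\<in>V. h \<noteq> 0 \<longrightarrow> h \<bullet> (H *v h) > 0)"

text \<open>
  Throughout, \<open>G x \<kappa>\<close> is the energy, the columns of \<open>P\<close> and \<open>Q\<close> select the input and the output
  nodes, \<open>v\<close> is the input and \<open>w\<close> the target.
\<close>

definition clamped ::
  "real^'i^'n \<Rightarrow> real^'o^'n \<Rightarrow> real^'i \<Rightarrow> real^'o \<Rightarrow> real^'n \<Rightarrow> bool" where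
  "clamped P Q v w x \<longleftrightarrow> transpose P *v x = v \<and> transpose Q *v x = w"

definition reference_state ::
  "(real^'n \<Rightarrow> real^'m \<Rightarrow> real) \<Rightarrow> real^'i^'n \<Rightarrow> real^'o^'n \<Rightarrow> real^'i \<Rightarrow> real^'o \<Rightarrow>
   real^'m \<Rightarrow> real^'n" where
  "reference_state G P Q v w \<kappa> = arg_min (\<lambda>x. G x \<kappa>) (clamped P Q v w)"

text \<open>
  The multiplier of the output constraint. It is unique because the columns of \<open>P\<close> and \<open>Q\<close>
  together are distinct standard basis vectors.
\<close>

definition adjoint_error ::
  "(real^'n \<Rightarrow> real^'m \<Rightarrow> real) \<Rightarrow> real^'i^'n \<Rightarrow> real^'o^'n \<Rightarrow> real^'i \<Rightarrow> real^'o \<Rightarrow>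
   real^'m \<Rightarrow> real^'o" where
  "adjoint_error G P Q v w \<kappa> =
     (THE \<mu>. \<exists>\<nu>. gradient (\<lambda>x. G x \<kappa>) (reference_state G P Q v w \<kappa>) = - (P *v \<nu>) - Q *v \<mu>)"

definition adjoint_loss ::
  "(real^'n \<Rightarrow> real^'m \<Rightarrow> real) \<Rightarrow> real^'i^'n \<Rightarrow> real^'o^'n \<Rightarrow> real^'i \<Rightarrow> real^'o \<Rightarrow>
   real^'m \<Rightarrow> real" where
  "adjoint_loss G P Q v w \<kappa> = (norm (adjoint_error G P Q v w \<kappa>))\<^sup>2 / 2"

definition reference_hessian ::
  "(real^'n \<Rightarrow> real^'m \<Rightarrow> real) \<Rightarrow> real^'i^'n \<Rightarrow> real^'o^'n \<Rightarrow> real^'i \<Rightarrow> real^'o \<Rightarrow>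
   real^'m \<Rightarrow> real^'n^'n" where
  "reference_hessian G P Q v w \<kappa> = hessian (\<lambda>x. G x \<kappa>) (reference_state G P Q v w \<kappa>)"

definition AL_resolvent :: "real^'n^'n \<Rightarrow> real^'i^'n \<Rightarrow> real^'n \<Rightarrow> real^'n" where
  "AL_resolvent H P f = (THE y. (\<exists>\<nu>. H *v y + P *v \<nu> = f) \<and> transpose P *v y = 0)"

definition AL_D :: "real^'n^'n \<Rightarrow> real^'i^'n \<Rightarrow> real^'o^'n \<Rightarrow> real^'o^'o" where
  "AL_D H P Q = matrix_inv (matrix (\<lambda>u. transpose Q *v AL_resolvent H P (Q *v u)))"

definition AL_response ::
  "(real^'n \<Rightarrow> real^'m \<Rightarrow> real) \<Rightarrow> real^'i^'n \<Rightarrow> real^'o^'n \<Rightarrow> real^'i \<Rightarrow> real^'o \<Rightarrow>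
   real^'m \<Rightarrow> real^'n" where
  "AL_response G P Q v w \<kappa> =
     (let H = reference_hessian G P Q v w \<kappa>
      in AL_resolvent H P (Q *v (AL_D H P Q *v adjoint_error G P Q v w \<kappa>)))"

text \<open>
  In the partial derivative with respect to \<open>\<kappa>\<^sub>i\<close> the reference state is held fixed; only the
  explicit parameter argument of \<open>G\<close> is varied.
\<close>

definition AL_field ::
  "(real^'n \<Rightarrow> real^'m \<Rightarrow> real) \<Rightarrow> real^'i^'n \<Rightarrow> real^'o^'n \<Rightarrow> real^'i \<Rightarrow> real^'o \<Rightarrow>
   real^'m \<Rightarrow> real^'m" where
  "AL_field G P Q v w \<kappa> =
     (\<chi> i. AL_response G P Q v w \<kappa> \<bullet>
        vector_derivative
          (\<lambda>s. gradient (\<lambda>x. G x (\<kappa> + s *\<^sub>R axis i 1)) (reference_state G P Q v w \<kappa>)) (at 0))"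

definition AL_flow_on ::
  "real set \<Rightarrow> (real^'m) set \<Rightarrow> (real^'n \<Rightarrow> real^'m \<Rightarrow> real) \<Rightarrow> real^'i^'n \<Rightarrow> real^'o^'n \<Rightarrow>
   real^'i \<Rightarrow> real^'o \<Rightarrow> (real \<Rightarrow> real^'m) \<Rightarrow> bool" where
  "AL_flow_on T U G P Q v w k \<longleftrightarrow>
     (\<forall>t\<in>T. k t \<in> U \<and> (k has_vector_derivative AL_field G P Q v w (k t)) (at t within T))"

definition param_range :: "(real^'m) set \<Rightarrow> 'm \<Rightarrow> real set" where
  "param_range U i = (\<lambda>\<kappa>. \<kappa> $ i) ` U"

text \<open>The condition \<open>f\<^sub>i' = g\<^sub>i / g\<^sub>i'\<close> on the \<open>f\<^sub>i\<close>, which it determines up to constants.\<close>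

definition K_summands :: "(real^'m) set \<Rightarrow> ('m \<Rightarrow> real \<Rightarrow> real) \<Rightarrow> ('m \<Rightarrow> real \<Rightarrow> real) \<Rightarrow> bool" where
  "K_summands U g f \<longleftrightarrow>
     (\<forall>i. \<forall>s\<in>param_range U i. (f i has_real_derivative g i s / deriv (g i) s) (at s))"

definition K_sum :: "('m \<Rightarrow> real \<Rightarrow> real) \<Rightarrow> real^'m \<Rightarrow> real" where
  "K_sum f \<kappa> = (\<Sum>i\<in>UNIV. f i (\<kappa> $ i))"

end

(*
  Along the flow, f_i'(kappa_i) * kappa_i' = g_i * <y, grad Gt_i(x0)>: the factor g_i' produced by
  differentiating grad G in kappa_i cancels, and summing over i reassembles <y, grad G(x0)>.
  Stationarity of x0 turns this into - <P^T y, lambda0> - <Q^T y, mu0>; here P^T y = 0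
  because y is a value of the resolvent, and D_AL is chosen precisely so that Q^T y = mu0.
*)
theory Submission
  imports Defs
begin

section \<open>Adjoints and gradients\<close>

lemma inner_matrix_vector_mult_transpose:
  fixes A :: "real^'a^'b"
  shows "y \<bullet> (A *v u) = (transpose A *v y) \<bullet> u"
  by (simp add: dot_lmul_matrix)

text \<open>Transposed products stay in the form \<open>transpose A *v x\<close>, in which the
  constraints and the resolvent are given; the simp rule would turn them into
  \<open>x v* A\<close>.\<close>

declare transpose_matrix_vector [simp del]

lemma GDERIV_unique:
  assumes "GDERIV f x :> D" "GDERIV f x :> E"
  shows "D = E"
proof -
  have "(\<lambda>h. h \<bullet> D) = (\<lambda>h. h \<bullet> E)"
    using assms unfolding gderiv_def by (rule has_derivative_unique)
  then show ?thesis
    by (metis inner_commute vector_eq_rdot)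
qed

lemma gradient_eqI: "GDERIV f x :> D \<Longrightarrow> gradient f x = D"
  unfolding gradient_def by (blast intro: GDERIV_unique)

lemma GDERIV_gradient:
  fixes f :: "'a::euclidean_space \<Rightarrow> real"
  assumes "f differentiable (at x)"
  shows "GDERIV f x :> gradient f x"
proof -
  obtain f' where f': "(f has_derivative f') (at x)"
    using assms by (auto simp: differentiable_def)
  \<comment> \<open>Riesz representation: the adjoint of a linear functional, evaluated at 1, is the
    vector that represents it.\<close>
  have "f' = (\<lambda>h. h \<bullet> adjoint f' 1)"
    using adjoint_works[OF has_derivative_linear[OF f'], of _ 1] by (simp add: fun_eq_iff)
  with f' have "GDERIV f x :> adjoint f' 1"
    unfolding gderiv_def by simp
  then show ?thesis
    by (simp add: gradient_eqI)
qed

lemma GDERIV_sum_scaled: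
  assumes "\<And>i. i \<in> I \<Longrightarrow> GDERIV (F i) x :> D i"
  shows "GDERIV (\<lambda>x. \<Sum>i\<in>I. c i * F i x) x :> (\<Sum>i\<in>I. c i *\<^sub>R D i)"
  using assms unfolding gderiv_def
  by (auto simp: inner_sum_right intro!: has_derivative_sum has_derivative_mult_right)

lemma smooth_on_imp_differentiable: "smooth_on S f \<Longrightarrow> x \<in> S \<Longrightarrow> f differentiable (at x)"
  unfolding smooth_on_def by (metis Ck_on.simps(2))

section \<open>Matrices whose columns are standard basis vectors\<close>

lemma matrix_entry_of_column:
  assumes "\<And>j. column j A = axis (p j) (1::real)"
  shows "A $ a $ j = (if a = p j then 1 else 0)"
proof -
  have "A $ a $ j = column j A $ a"
    by (simp add: column_def)
  then show ?thesis
    by (simp add: assms axis_def)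
qed

lemma selection_transpose_nth:
  fixes A :: "real^'a^'b"
  assumes "\<And>j. column j A = axis (p j) 1"
  shows "(transpose A *v x) $ j = x $ p j"
  by (simp add: matrix_vector_mult_def transpose_def matrix_entry_of_column[OF assms]
      if_distrib[of "\<lambda>t. t * _"] cong: if_cong)

text \<open>Injectivity of \<open>p\<close> leaves a single 1 in row \<open>p j\<close>, so the row
  sum collapses to one term.\<close>

lemma selection_nth:
  fixes A :: "real^'a^'b"
  assumes "\<And>j. column j A = axis (p j) 1" "inj p"
  shows "(A *v u) $ p j = u $ j"
  by (simp add: matrix_vector_mult_def matrix_entry_of_column[OF assms(1)] inj_eq[OF assms(2)]
      if_distrib[of "\<lambda>t. t * _"] cong: if_cong)

lemma selection_nth_eq_0:
  fixes A :: "real^'a^'b"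
  assumes "\<And>j. column j A = axis (p j) 1" "a \<notin> range p"
  shows "(A *v u) $ a = 0"
  using assms(2)
  by (auto simp: matrix_vector_mult_def matrix_entry_of_column[OF assms(1)] intro!: sum.neutral)

text \<open>The maps \<open>inp\<close> and \<open>out\<close> name the nodes behind the columns of
  \<open>P\<close> and \<open>Q\<close>. Injectivity and disjoint ranges say that all these columns
  together are distinct basis vectors, hence linearly independent.\<close>

locale input_output_nodes =
  fixes P :: "real^'i^'n" and Q :: "real^'o^'n"
    and inp :: "'i \<Rightarrow> 'n" and out :: "'o \<Rightarrow> 'n"
  assumes P: "\<And>j. column j P = axis (inp j) 1" and inj_inp: "inj inp"
    and Q: "\<And>j. column j Q = axis (out j) 1" and inj_out: "inj out"
    and disjoint: "range inp \<inter> range out = {}"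
begin

lemmas P_nth = selection_nth[OF P inj_inp] and Q_nth = selection_nth[OF Q inj_out]
  and Pt_nth = selection_transpose_nth[OF P] and Qt_nth = selection_transpose_nth[OF Q]
  and P_nth_eq_0 = selection_nth_eq_0[OF P] and Q_nth_eq_0 = selection_nth_eq_0[OF Q]

lemma out_notin: "out l \<notin> range inp" and inp_notin: "inp j \<notin> range out"
  using disjoint by blast+

section \<open>Lagrange multipliers, stationarity and the saddle-point system\<close>

lemma P_cancel: "P *v \<nu> = P *v \<nu>' \<Longrightarrow> \<nu> = \<nu>'"
  by (metis P_nth vec_eq_iff)

text \<open>At node \<open>out l\<close> the \<open>P\<close> term vanishes by disjointness and the
  \<open>Q\<close> term reads off entry \<open>l\<close> of the multiplier. This makes the
  \<open>THE\<close> in \<open>adjoint_error\<close> well defined and later gives injectivity of the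
  output response.\<close>

lemma multipliers_unique:
  assumes "P *v \<nu> + Q *v \<mu> = P *v \<nu>' + Q *v \<mu>'"
  shows "\<mu> = \<mu>'"
proof -
  have "(P *v \<nu> + Q *v \<mu>) $ out l = \<mu> $ l" for \<nu> \<mu> l
    by (simp add: Q_nth P_nth_eq_0[OF out_notin])
  then show ?thesis
    using assms by (metis vec_eq_iff)
qed

text \<open>The columns of \<open>P\<close> and \<open>Q\<close> span exactly the coordinates at
  input and output nodes; the multipliers are the negated entries of \<open>d\<close> there.\<close>

lemma multipliers_exist:
  assumes "\<And>a. a \<notin> range inp \<Longrightarrow> a \<notin> range out \<Longrightarrow> d $ a = 0"
  shows "\<exists>\<mu> \<nu>. d = - (P *v \<nu>) - Q *v \<mu>"
proof (intro exI)
  show "d = - (P *v (\<chi> j. - d $ inp j)) - Q *v (\<chi> l. - d $ out l)"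
  proof (subst vec_eq_iff, rule allI)
    fix a
    consider j where "a = inp j" | l where "a = out l" | "a \<notin> range inp" "a \<notin> range out"
      by blast
    then show "d $ a = (- (P *v (\<chi> j. - d $ inp j)) - Q *v (\<chi> l. - d $ out l)) $ a"
      by cases
        (simp_all add: assms P_nth Q_nth P_nth_eq_0 Q_nth_eq_0 out_notin inp_notin)
  qed
qed

text \<open>Supplies the admissible variations for stationarity: neither constraint reads a
  coordinate outside both ranges.\<close>

lemma clamped_add_axis:
  assumes "clamped P Q v w x" "a \<notin> range inp" "a \<notin> range out"
  shows "clamped P Q v w (x + s *\<^sub>R axis a 1)"
proof -
  have "transpose P *v axis a 1 = 0" "transpose Q *v axis a 1 = 0"
    using assms(2,3) by (auto simp: vec_eq_iff Pt_nth Qt_nth axis_def)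
  then show ?thesis
    using assms(1) by (simp add: clamped_def matrix_vector_right_distrib matrix_vector_mult_scaleR)
qed

text \<open>Fermat's rule along the coordinate line of a free node, which stays inside the
  constraint set.\<close>

lemma stationary_nth_eq_0:
  assumes min: "is_arg_min F (clamped P Q v w) x" and D: "GDERIV F x :> D"
    and a: "a \<notin> range inp" "a \<notin> range out"
  shows "D $ a = (0::real)"
proof -
  have "((\<lambda>s. F (x + s *\<^sub>R axis a 1)) has_real_derivative D $ a) (at 0)"
  proof -
    have "((\<lambda>s. x + s *\<^sub>R axis a 1) has_derivative (\<lambda>s. s *\<^sub>R axis a 1)) (at 0)"
      by (auto intro!: derivative_eq_intros)
    moreover have "(F has_derivative (\<lambda>h. h \<bullet> D)) (at (x + 0 *\<^sub>R axis a 1))"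
      using D by (simp add: gderiv_def)
    ultimately have "((\<lambda>s. F (x + s *\<^sub>R axis a 1)) has_derivative (\<lambda>s. (s *\<^sub>R axis a 1) \<bullet> D)) (at 0)"
      by (rule has_derivative_compose)
    then show ?thesis
      by (simp add: has_field_derivative_def inner_axis' mult_commute_abs)
  qed
  moreover have "F (x + 0 *\<^sub>R axis a 1) \<le> F (x + s *\<^sub>R axis a 1)" for s
    using min clamped_add_axis[OF _ a, of v w x s] by (auto simp: is_arg_min_def not_less)
  ultimately show ?thesis
    \<comment> \<open>The radius 1 is arbitrary, since the inequality holds for every
      \<open>s\<close>.\<close>
    by (intro DERIV_local_min[of _ _ 0 1]) auto
qed

text \<open>Positive definiteness on \<open>ker P\<^sup>T\<close> makes the homogeneous saddle-point system injective;
  being square, it is then solvable.\<close>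

lemma AL_resolvent_ex1:
  fixes H :: "real^'n^'n"
  assumes H: "pos_def_on {h. transpose P *v h = 0} H"
  shows "\<exists>!y. (\<exists>\<nu>. H *v y + P *v \<nu> = r) \<and> transpose P *v y = 0"
proof -
  have hom: "y = 0" if "H *v y + P *v \<nu> = 0" "transpose P *v y = 0" for y \<nu>
  proof (rule ccontr)
    assume "y \<noteq> 0"
    then have "y \<bullet> (H *v y) > 0"
      using H that(2) by (simp add: pos_def_on_def)
    \<comment> \<open>The first equation is tested against \<open>y\<close>; the multiplier term
      then drops out because \<open>transpose P *v y = 0\<close>.\<close>
    moreover have "y \<bullet> (H *v y) + y \<bullet> (P *v \<nu>) = 0"
      by (metis inner_add_right inner_zero_right that(1))
    ultimately show False
      by (simp add: inner_matrix_vector_mult_transpose[of _ P] that(2))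
  qed
  \<comment> \<open>\<open>L\<close> is the saddle-point operator on pairs of a state and an input
    multiplier. It maps this space to itself, so injectivity gives surjectivity.\<close>
  define L where "L z = (H *v fst z + P *v snd z, transpose P *v fst z)" for z :: "(real^'n) \<times> (real^'i)"
  have "linear L"
    unfolding L_def
    by (rule linearI) (simp_all add: matrix_vector_right_distrib matrix_vector_mult_scaleR scaleR_add_right)
  moreover have "inj L"
    unfolding linear_injective_0[OF \<open>linear L\<close>]
  proof (intro allI impI)
    fix z assume "L z = 0"
    then have z: "H *v fst z + P *v snd z = 0" "transpose P *v fst z = 0"
      by (simp_all add: L_def zero_prod_def)
    then have "fst z = 0"
      by (rule hom)
    moreover from this z have "snd z = 0"
      by (intro P_cancel) simp
    ultimately show "z = 0"
      by (simp add: prod_eq_iff)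
  qed
  ultimately have "surj L"
    by (rule linear_injective_imp_surjective) simp
  then obtain z where "L z = (r, 0)"
    by (metis surjD)
  then have ex: "(\<exists>\<nu>. H *v fst z + P *v \<nu> = r) \<and> transpose P *v fst z = 0"
    by (auto simp: L_def)
  show ?thesis
  proof (rule ex1I[where a = "fst z"], rule ex)
    fix y assume y: "(\<exists>\<nu>. H *v y + P *v \<nu> = r) \<and> transpose P *v y = 0"
    obtain \<nu> \<nu>' where "H *v y + P *v \<nu> = r" "H *v fst z + P *v \<nu>' = r"
      using y ex by blast
    then have "H *v (y - fst z) + P *v (\<nu> - \<nu>') = 0"
      by (simp add: matrix_vector_mult_diff_distrib algebra_simps)
    moreover have "transpose P *v (y - fst z) = 0"
      using y ex by (simp add: matrix_vector_mult_diff_distrib)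
    ultimately show "y = fst z"
      using hom by fastforce
  qed
qed

section \<open>Linearity of the resolvent and inversion of its output block\<close>

context
  fixes H :: "real^'n^'n"
  assumes H: "pos_def_on {h. transpose P *v h = 0} H"
begin

lemma AL_resolvent_solves:
  shows "\<exists>\<nu>. H *v AL_resolvent H P r + P *v \<nu> = r" and "transpose P *v AL_resolvent H P r = 0"
  using theI'[OF AL_resolvent_ex1[OF H, of r]] by (auto simp: AL_resolvent_def)

lemma AL_resolvent_eqI:
  "H *v y + P *v \<nu> = r \<Longrightarrow> transpose P *v y = 0 \<Longrightarrow> AL_resolvent H P r = y"
  using AL_resolvent_ex1[OF H, of r] AL_resolvent_solves[of r] by blast

text \<open>A consequence of uniqueness: solutions and their multipliers add and scale together.
  Linearity is what lets the \<open>matrix\<close> in \<open>AL_D\<close> represent the output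
  response faithfully.\<close>

lemma linear_AL_resolvent: "linear (AL_resolvent H P)"
proof (rule linearI)
  fix r r' and c :: real
  obtain \<nu> \<nu>' where \<nu>: "H *v AL_resolvent H P r + P *v \<nu> = r"
    and \<nu>': "H *v AL_resolvent H P r' + P *v \<nu>' = r'"
    using AL_resolvent_solves(1) by metis
  show "AL_resolvent H P (r + r') = AL_resolvent H P r + AL_resolvent H P r'"
  proof (rule AL_resolvent_eqI)
    show "H *v (AL_resolvent H P r + AL_resolvent H P r') + P *v (\<nu> + \<nu>') = r + r'"
      using arg_cong2[where f = "(+)", OF \<nu> \<nu>']
      by (simp add: matrix_vector_right_distrib algebra_simps)
  qed (simp add: matrix_vector_right_distrib AL_resolvent_solves(2))
  show "AL_resolvent H P (c *\<^sub>R r) = c *\<^sub>R AL_resolvent H P r"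
  proof (rule AL_resolvent_eqI)
    show "H *v (c *\<^sub>R AL_resolvent H P r) + P *v (c *\<^sub>R \<nu>) = c *\<^sub>R r"
      by (metis \<nu> matrix_vector_mult_scaleR scaleR_add_right)
  qed (simp add: matrix_vector_mult_scaleR AL_resolvent_solves(2))
qed

text \<open>\<open>AL_D\<close> is the inverse of the matrix of the output response
  \<open>S\<close>, so the point is that \<open>S\<close> is invertible; being a linear endomorphism
  in finite dimension, it only has to be injective.\<close>

lemma output_resolvent_AL_D:
  "transpose Q *v AL_resolvent H P (Q *v (AL_D H P Q *v \<mu>)) = \<mu>"
proof -
  define S where "S u = transpose Q *v AL_resolvent H P (Q *v u)" for u
  have "linear S"
    using linear_compose[OF linear_compose[OF matrix_vector_mul_linear[of Q] linear_AL_resolvent]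
        matrix_vector_mul_linear[of "transpose Q"]]
    by (simp add: S_def[abs_def] o_def)
  then have matrix_S: "matrix S *v u = S u" for u
    by (simp add: matrix_works linear_matrix_vector_mul_eq)
  have "inj S"
    unfolding linear_injective_0[OF \<open>linear S\<close>]
  proof (intro allI impI)
    fix u assume u: "S u = 0"
    define y where "y = AL_resolvent H P (Q *v u)"
    obtain \<nu> where \<nu>: "H *v y + P *v \<nu> = Q *v u"
      using AL_resolvent_solves(1) unfolding y_def by blast
    have Pty: "transpose P *v y = 0"
      unfolding y_def by (rule AL_resolvent_solves(2))
    \<comment> \<open>Testing against \<open>y\<close> leaves only the Hessian term:
      \<open>transpose P *v y\<close> is 0 by the constraint and \<open>transpose Q *v y\<close> is
      0 because \<open>S u = 0\<close>.\<close>
    have "y \<bullet> (H *v y) + y \<bullet> (P *v \<nu>) = y \<bullet> (Q *v u)"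
      by (metis \<nu> inner_add_right)
    then have "y \<bullet> (H *v y) = 0"
      using u by (simp add: inner_matrix_vector_mult_transpose[of _ P]
          inner_matrix_vector_mult_transpose[of _ Q] Pty S_def y_def[symmetric])
    then have "y = 0"
      using H Pty unfolding pos_def_on_def by force
    \<comment> \<open>With \<open>y = 0\<close> the equation reads
      \<open>P *v \<nu> = Q *v u\<close>; the zero terms bring it into the shape of
      \<open>multipliers_unique\<close>.\<close>
    then have "P *v \<nu> + Q *v 0 = P *v 0 + Q *v u"
      using \<nu> by simp
    then show "u = 0"
      by (metis multipliers_unique)
  qed
  then have "invertible (matrix S)"
    unfolding invertible_left_inverse matrix_left_invertible_injective
    by (simp add: matrix_S[abs_def])
  \<comment> \<open>\<open>matrix_inv\<close> is a choice, so it has the inverse property only once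
    invertibility is known.\<close>
  then have "matrix S ** matrix_inv (matrix S) = mat 1"
    unfolding invertible_def matrix_inv_def by (metis (mono_tags, lifting) someI_ex)
  then have "matrix S *v (AL_D H P Q *v \<mu>) = \<mu>"
    by (simp add: AL_D_def S_def[abs_def] matrix_vector_mul_assoc)
  then show ?thesis
    by (simp add: matrix_S S_def)
qed

end

end

text \<open>A single instant of negative derivative suffices: \<open>F\<close> is nonincreasing, so
  equal end values would make it constant on \<open>{s..t}\<close>, with zero derivative at
  \<open>r\<close>.\<close>

lemma strict_decrease_on_interval:
  fixes F :: "real \<Rightarrow> real"
  assumes T: "is_interval T" and F: "\<And>t. t \<in> T \<Longrightarrow> (F has_real_derivative F' t) (at t within T)"
    and F'_le: "\<And>t. t \<in> T \<Longrightarrow> F' t \<le> 0"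
    and s: "s \<in> T" and t: "t \<in> T" and "s < t" and r: "r \<in> {s..t}" and "F' r < 0"
  shows "F t < F s"
proof -
  have sub: "{s..t} \<subseteq> T"
    using mem_is_interval_1_I[OF T s t] by auto
  have der: "(F has_real_derivative F' q) (at q within {s..t})" if "q \<in> {s..t}" for q
    by (rule DERIV_subset[OF F sub]) (use that sub in blast)
  have mono: "F b \<le> F a" if "s \<le> a" "a \<le> b" "b \<le> t" for a b
  proof (rule DERIV_nonpos_imp_decreasing_open[OF that(2)])
    fix q assume q: "a < q" "q < b"
    have "(F has_real_derivative F' q) (at q within {a..b})"
      by (rule DERIV_subset[OF der]) (use q that in auto)
    \<comment> \<open>At interior points the derivative relative to the interval is two-sided, as
      the monotonicity criterion requires.\<close>
    moreover have "at q within {a..b} = at q"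
      using q by (intro at_within_interior) (simp add: interior_atLeastAtMost_real)
    moreover have "q \<in> T"
      using sub q that by auto
    ultimately show "\<exists>y. (F has_real_derivative y) (at q) \<and> y \<le> 0"
      using F'_le by auto
  next
    show "continuous_on {a..b} F"
      by (rule DERIV_continuous_on[where D = F'], rule DERIV_subset[OF der]) (use that in auto)
  qed
  have "F t \<noteq> F s"
  proof
    assume eq: "F t = F s"
    have const: "F q = F s" if "q \<in> {s..t}" for q
      using mono[of s q] mono[of q t] that eq by auto
    have "((\<lambda>q. F s) has_vector_derivative F' r) (at r within {s..t})"
      using der[OF r] unfolding has_real_derivative_iff_has_vector_derivative
      by (rule has_vector_derivative_transform[OF r, rotated]) (rule const[symmetric])
    moreover have "((\<lambda>q. F s) has_vector_derivative 0) (at r within {s..t})"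
      by (rule has_vector_derivative_const)
    ultimately have "F' r = 0"
      \<comment> \<open>Relative derivatives are unique on a nondegenerate interval even at its end
        points, so \<open>r\<close> may be \<open>s\<close> or \<open>t\<close>.\<close>
      by (rule vector_derivative_unique_within_closed_interval[OF \<open>s < t\<close>, unfolded box_real, OF r])
    then show False
      using \<open>F' r < 0\<close> by simp
  qed
  with mono[of s t] \<open>s < t\<close> show ?thesis
    by simp
qed

section \<open>The derivative of \<open>K\<close> along the flow\<close>

theorem proposition1:
  fixes P :: "real^'i^'n" and Q :: "real^'o^'n"
    and inp :: "'i \<Rightarrow> 'n" and out :: "'o \<Rightarrow> 'n"
    and v :: "real^'i" and w :: "real^'o"
    and U :: "(real^'m) set"
    and G :: "real^'n \<Rightarrow> real^'m \<Rightarrow> real"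
    and g :: "'m \<Rightarrow> real \<Rightarrow> real" and Gt :: "'m \<Rightarrow> real^'n \<Rightarrow> real"
    and f :: "'m \<Rightarrow> real \<Rightarrow> real"
    and T :: "real set" and k :: "real \<Rightarrow> real^'m"
  assumes P: "\<And>j. column j P = axis (inp j) 1" and inj_inp: "inj inp"
    and Q: "\<And>j. column j Q = axis (out j) 1" and inj_out: "inj out"
    and disjoint: "range inp \<inter> range out = {}"
    and U: "open U"
    and smooth_g: "\<And>i. smooth_on (param_range U i) (g i)"
    and g'_nonzero: "\<And>i s. s \<in> param_range U i \<Longrightarrow> deriv (g i) s \<noteq> 0"
    and smooth_Gt: "\<And>i. smooth_on UNIV (Gt i)"
    and separates: "\<And>\<kappa> x. \<kappa> \<in> U \<Longrightarrow> G x \<kappa> = (\<Sum>i\<in>UNIV. g i (\<kappa> $ i) * Gt i x)"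
    and reference: "\<And>\<kappa>. \<kappa> \<in> U \<Longrightarrow> \<exists>!x. is_arg_min (\<lambda>x. G x \<kappa>) (clamped P Q v w) x"
    and hessian_pos: "\<And>\<kappa>. \<kappa> \<in> U \<Longrightarrow>
           pos_def_on {h. transpose P *v h = 0} (reference_hessian G P Q v w \<kappa>)"
    and f: "K_summands U g f"
    and T: "is_interval T"
    and flow: "AL_flow_on T U G P Q v w k"
  shows "(\<forall>t\<in>T. ((\<lambda>t. K_sum f (k t)) has_real_derivative
              - (norm (adjoint_error G P Q v w (k t)))\<^sup>2) (at t within T))
       \<and> (\<forall>t\<in>T. - (norm (adjoint_error G P Q v w (k t)))\<^sup>2 = - 2 * adjoint_loss G P Q v w (k t))
       \<and> (\<forall>s\<in>T. \<forall>t\<in>T. s < t \<and> (\<exists>r\<in>{s..t}. adjoint_error G P Q v w (k r) \<noteq> 0)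
              \<longrightarrow> K_sum f (k t) < K_sum f (k s))
       \<and> ((\<forall>i. \<forall>s\<in>param_range U i. g i s = s) \<longrightarrow>
              K_summands U g (\<lambda>i s. s\<^sup>2 / 2)
              \<and> (\<forall>\<kappa>\<in>U. K_sum (\<lambda>i s. s\<^sup>2 / 2) \<kappa> = (\<Sum>i\<in>UNIV. (\<kappa> $ i)\<^sup>2) / 2))"
proof -
  interpret input_output_nodes P Q inp out
    by unfold_locales (use P inj_inp Q inj_out disjoint in auto)
  define \<mu> where "\<mu> \<kappa> = adjoint_error G P Q v w \<kappa>" for \<kappa>
  define x0 where "x0 \<kappa> = reference_state G P Q v w \<kappa>" for \<kappa>
  define y where "y \<kappa> = AL_response G P Q v w \<kappa>" for \<kappa>

  have grad: "GDERIV (\<lambda>x. G x \<kappa>) x :> (\<Sum>i\<in>UNIV. g i (\<kappa> $ i) *\<^sub>R gradient (Gt i) x)"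
    if "\<kappa> \<in> U" for \<kappa> x
    unfolding separates[OF that]
    by (intro GDERIV_sum_scaled GDERIV_gradient smooth_on_imp_differentiable[OF smooth_Gt]) simp
  note gradient_eq = gradient_eqI[OF grad]

  have param: "\<kappa> $ i \<in> param_range U i" if "\<kappa> \<in> U" for \<kappa> i
    using that by (auto simp: param_range_def)
  have g_deriv: "(g i has_real_derivative deriv (g i) s) (at s)" if "s \<in> param_range U i" for i s
    using smooth_on_imp_differentiable[OF smooth_g that]
    by (simp add: DERIV_deriv_iff_real_differentiable)

  have stationary: "\<exists>\<nu>. gradient (\<lambda>x. G x \<kappa>) (x0 \<kappa>) = - (P *v \<nu>) - Q *v \<mu> \<kappa>"
    if "\<kappa> \<in> U" for \<kappa>
  proof -
    \<comment> \<open>\<open>arg_min\<close> is a Hilbert choice; existence makes the chosen state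
      an actual minimiser.\<close>
    have "is_arg_min (\<lambda>x. G x \<kappa>) (clamped P Q v w) (x0 \<kappa>)"
      using reference[OF that] unfolding x0_def reference_state_def arg_min_def by (metis someI_ex)
    then have "\<exists>\<mu> \<nu>. gradient (\<lambda>x. G x \<kappa>) (x0 \<kappa>) = - (P *v \<nu>) - Q *v \<mu>"
      unfolding gradient_eq[OF that]
      by (intro multipliers_exist) (rule stationary_nth_eq_0[OF _ grad[OF that]])
    then obtain \<mu>' \<nu>' where eq: "gradient (\<lambda>x. G x \<kappa>) (x0 \<kappa>) = - (P *v \<nu>') - Q *v \<mu>'"
      by blast
    \<comment> \<open>Uniqueness identifies the \<open>THE\<close> of \<open>adjoint_error\<close>
      with the multiplier just found.\<close>
    have "\<mu>'' = \<mu>'" if "gradient (\<lambda>x. G x \<kappa>) (x0 \<kappa>) = - (P *v \<nu>) - Q *v \<mu>''" for \<mu>'' \<nu>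
      using that eq by (intro multipliers_unique[of \<nu> _ \<nu>']) (simp add: algebra_simps)
    then have "\<mu> \<kappa> = \<mu>'"
      unfolding \<mu>_def adjoint_error_def x0_def[symmetric] using eq by (intro the_equality) blast+
    with eq show ?thesis
      by blast
  qed

  have y: "transpose P *v y \<kappa> = 0" "transpose Q *v y \<kappa> = \<mu> \<kappa>" if "\<kappa> \<in> U" for \<kappa>
    unfolding y_def \<mu>_def AL_response_def Let_def
    by (rule AL_resolvent_solves(2) output_resolvent_AL_D, rule hessian_pos[OF that])+

  have power: "y \<kappa> \<bullet> gradient (\<lambda>x. G x \<kappa>) (x0 \<kappa>) = - (norm (\<mu> \<kappa>))\<^sup>2" if \<kappa>: "\<kappa> \<in> U" for \<kappa>
    using stationary[OF \<kappa>]
    by (auto simp: inner_diff_right inner_matrix_vector_mult_transpose y[OF \<kappa>] power2_norm_eq_inner)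

  have field: "AL_field G P Q v w \<kappa> $ i = deriv (g i) (\<kappa> $ i) * (y \<kappa> \<bullet> gradient (Gt i) (x0 \<kappa>))"
    if \<kappa>: "\<kappa> \<in> U" for \<kappa> i
  proof -
    let ?line = "\<lambda>s. \<kappa> + s *\<^sub>R axis i (1::real)"
    \<comment> \<open>The energy is known to separate only for parameters in \<open>U\<close>. The
      perturbed parameter stays in \<open>U\<close> for \<open>s\<close> in an open neighbourhood of
      0, where the separated gradient can be differentiated instead.\<close>
    have "open (?line -` U)"
      by (intro open_vimage U continuous_intros)
    \<comment> \<open>Along axis \<open>i\<close> only coordinate \<open>i\<close> of the parameter
      moves, so all other summands are constant in \<open>s\<close>.\<close>
    have "((\<lambda>s. g j (?line s $ j) *\<^sub>R gradient (Gt j) (x0 \<kappa>)) has_vector_derivative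
        (if j = i then deriv (g i) (\<kappa> $ i) *\<^sub>R gradient (Gt i) (x0 \<kappa>) else 0)) (at 0)" for j
    proof (cases "j = i")
      case True
      have "((\<lambda>s. g i (\<kappa> $ i + s)) has_real_derivative deriv (g i) (\<kappa> $ i)) (at 0)"
        using g_deriv[OF param[OF \<kappa>, of i]] DERIV_shift[of "g i" _ "0::real" "\<kappa> $ i"]
        by (simp add: add.commute)
      then show ?thesis
        using True by (auto intro!: derivative_eq_intros)
    qed (simp add: axis_def)
    then have "((\<lambda>s. \<Sum>j\<in>UNIV. g j (?line s $ j) *\<^sub>R gradient (Gt j) (x0 \<kappa>)) has_vector_derivative
        (\<Sum>j\<in>UNIV. if j = i then deriv (g i) (\<kappa> $ i) *\<^sub>R gradient (Gt i) (x0 \<kappa>) else 0)) (at 0)"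
      by (intro has_vector_derivative_sum)
    then have "((\<lambda>s. \<Sum>j\<in>UNIV. g j (?line s $ j) *\<^sub>R gradient (Gt j) (x0 \<kappa>)) has_vector_derivative
        deriv (g i) (\<kappa> $ i) *\<^sub>R gradient (Gt i) (x0 \<kappa>)) (at 0)"
      by simp
    then have "((\<lambda>s. gradient (\<lambda>x. G x (?line s)) (x0 \<kappa>)) has_vector_derivative
        deriv (g i) (\<kappa> $ i) *\<^sub>R gradient (Gt i) (x0 \<kappa>)) (at 0)"
      by (rule has_vector_derivative_transform_within_open[OF _ \<open>open (?line -` U)\<close>])
        (use \<kappa> in \<open>simp_all add: gradient_eq\<close>)
    then show ?thesis
      by (simp add: AL_field_def x0_def[symmetric] y_def[symmetric] vector_derivative_at)
  qed

  have K_deriv: "((\<lambda>t. K_sum f (k t)) has_real_derivative - (norm (\<mu> (k t)))\<^sup>2) (at t within T)"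
    if t: "t \<in> T" for t
  proof -
    have kt: "k t \<in> U"
      and k': "(k has_vector_derivative AL_field G P Q v w (k t)) (at t within T)"
      using flow t by (auto simp: AL_flow_on_def)
    have "((\<lambda>t. f i (k t $ i)) has_real_derivative
        g i (k t $ i) * (y (k t) \<bullet> gradient (Gt i) (x0 (k t)))) (at t within T)" for i
    proof -
      have "((\<lambda>t. k t $ i) has_real_derivative AL_field G P Q v w (k t) $ i) (at t within T)"
        using bounded_linear.has_vector_derivative[OF bounded_linear_vec_nth k']
        by (simp add: has_real_derivative_iff_has_vector_derivative)
      moreover have "(f i has_real_derivative g i (k t $ i) / deriv (g i) (k t $ i)) (at (k t $ i))"
        using f param[OF kt] by (simp add: K_summands_def)
      \<comment> \<open>The outer derivative is two-sided and the inner one relative to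
        \<open>T\<close>, so the composite is relative to \<open>T\<close>, end points
        included.\<close>
      ultimately have "((\<lambda>t. f i (k t $ i)) has_real_derivative
          g i (k t $ i) / deriv (g i) (k t $ i) * AL_field G P Q v w (k t) $ i) (at t within T)"
        by (rule DERIV_chain2[rotated])
      then show ?thesis
        by (simp add: field[OF kt] g'_nonzero[OF param[OF kt]])
    qed
    then have "((\<lambda>t. K_sum f (k t)) has_real_derivative
        (\<Sum>i\<in>UNIV. g i (k t $ i) * (y (k t) \<bullet> gradient (Gt i) (x0 (k t))))) (at t within T)"
      unfolding K_sum_def by (intro DERIV_sum)
    also have "(\<Sum>i\<in>UNIV. g i (k t $ i) * (y (k t) \<bullet> gradient (Gt i) (x0 (k t)))) =
        y (k t) \<bullet> gradient (\<lambda>x. G x (k t)) (x0 (k t))"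
      by (simp add: gradient_eq[OF kt] inner_sum_right)
    finally show ?thesis
      by (simp add: power[OF kt])
  qed

  have strict: "K_sum f (k t) < K_sum f (k s)"
    if "s \<in> T" "t \<in> T" "s < t" "r \<in> {s..t}" "\<mu> (k r) \<noteq> 0" for s t r
    by (rule strict_decrease_on_interval[OF T K_deriv _ that(1-4)]) (use that in auto)

  have conductance: "K_summands U g (\<lambda>i s. s\<^sup>2 / 2)"
    if id: "\<forall>i. \<forall>s\<in>param_range U i. g i s = s"
    unfolding K_summands_def
  proof (intro allI ballI)
    fix i s assume s: "s \<in> param_range U i"
    \<comment> \<open>Coordinate projections are open maps. Hence \<open>g i\<close> is the identity
      on a whole neighbourhood of \<open>s\<close>, which fixes its derivative there.\<close>
    have "open (param_range U i)"
      using open_image_vec_nth[OF U] by (simp add: param_range_def)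
    then have "(g i has_real_derivative 1) (at s)"
      using has_field_derivative_transform_within_open[OF DERIV_ident _ s, of "g i"] id by simp
    then have "deriv (g i) s = 1"
      by (rule DERIV_imp_deriv)
    moreover have "((\<lambda>s. s\<^sup>2 / 2) has_real_derivative s) (at s)"
      by (auto intro!: derivative_eq_intros)
    ultimately show "((\<lambda>s. s\<^sup>2 / 2) has_real_derivative g i s / deriv (g i) s) (at s)"
      using id s by simp
  qed

  show ?thesis
    using K_deriv strict conductance
    by (auto simp: \<mu>_def adjoint_loss_def K_sum_def sum_divide_distrib)
qed

end
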